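(* Let $n_1,n_2\ge 1$, let $M\subseteq\mathbb{R}^{2n_1+2n_2}$ be an open set with coordinates $(q_1,p_1,q_2,p_2)$, where $q_1,p_1\in\mathbb{R}^{n_1}$ and $q_2,p_2\in\mathbb{R}^{n_2}$. Let $H_1=H_1(q_1,p_1)$ and $H_2=H_2(q_2,p_2)$ be smooth real-valued functions on $M$, depending only on the indicated variables, and let $f_1:M\to\mathbb{R}^{n_1}$ and $f_2:M\to\mathbb{R}^{n_2}$ be smooth maps. Let $X$ be the vector field on $M$ defined by the coupled system $$\frac{\mathrm{d}q_1}{\mathrm{d}t}=\frac{\partial H_1}{\partial p_1},\quad \frac{\mathrm{d}p_1}{\mathrm{d}t}=-\frac{\partial H_1}{\partial q_1}+f_1,\quad \frac{\mathrm{d}q_2}{\mathrm{d}t}=\frac{\partial H_2}{\partial p_2},\quad \frac{\mathrm{d}p_2}{\mathrm{d}t}=-\frac{\partial H_2}{\partial q_2}+f_2,$$ and let $\omega=\mathrm{d}q_1\wedge\mathrm{d}p_1+\mathrm{d}q_2\wedge\mathrm{d}p_2$ be the standard symplectic form. If $$\mathrm{d}f_1\wedge\mathrm{d}q_1+\mathrm{d}f_2\wedge\mathrm{d}q_2=0,$$ then the coupled system preserves the symplectic form $\omega$, that is, $\mathcal{L}_X\omega=0$.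
   Context: For vector-valued quantities, wedge products are summed over components: for $k=1,2$, $\mathrm{d}q_k\wedge\mathrm{d}p_k=\sum_{i=1}^{n_k}\mathrm{d}(q_k)_i\wedge\mathrm{d}(p_k)_i$ and $\mathrm{d}f_k\wedge\mathrm{d}q_k=\sum_{i=1}^{n_k}\mathrm{d}(f_k)_i\wedge\mathrm{d}(q_k)_i$, where $\mathrm{d}$ is the exterior derivative on $M$ (the interaction terms $f_1,f_2$ may depend on all of $q_1,p_1,q_2,p_2$). $\mathcal{L}_X$ denotes the Lie derivative with respect to $X$. A vector field $X$ is said to preserve $\omega$ (to be symplectic) if $\mathcal{L}_X\omega=0$. *)

theory Defs
  imports "HOL-Analysis.Analysis"
begin

section \<open>Smooth maps on an open set\<close>

text \<open>The notion is meant for open sets in a Euclidean space, where differentiability together with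
  \<open>C\<^sup>k\<close> directional derivatives in every (constant) direction is the usual \<open>C\<^sup>k\<^sup>+\<^sup>1\<close>.\<close>

primrec Ck_on :: "nat \<Rightarrow> 'a::euclidean_space set \<Rightarrow> ('a \<Rightarrow> 'b::real_normed_vector) \<Rightarrow> bool" where
  "Ck_on 0 M f \<longleftrightarrow> continuous_on M f"
| "Ck_on (Suc k) M f \<longleftrightarrow>
     (\<forall>x\<in>M. f differentiable (at x)) \<and> (\<forall>v. Ck_on k M (\<lambda>x. frechet_derivative f (at x) v))"

definition smooth_on :: "'a::euclidean_space set \<Rightarrow> ('a \<Rightarrow> 'b::real_normed_vector) \<Rightarrow> bool" where
  "smooth_on M f \<longleftrightarrow> (\<forall>k. Ck_on k M f)"


section \<open>Differential forms and the Lie derivative\<close>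

text \<open>A 1-form sends a base point and a tangent vector to a number; a 2-form takes two
  tangent vectors. The tangent spaces of an open subset of \<open>'a\<close> are identified with \<open>'a\<close>.
  Forms and vector fields are total functions, of which only the values on the open set matter.\<close>

type_synonym 'a form1 = "'a \<Rightarrow> 'a \<Rightarrow> real"
type_synonym 'a form2 = "'a \<Rightarrow> 'a \<Rightarrow> 'a \<Rightarrow> real"

definition ext_d :: "('a::real_normed_vector \<Rightarrow> real) \<Rightarrow> 'a form1" where
  "ext_d f x v = frechet_derivative f (at x) v"

definition wedge :: "'a form1 \<Rightarrow> 'a form1 \<Rightarrow> 'a form2" where
  "wedge \<alpha> \<beta> x u v = \<alpha> x u * \<beta> x v - \<alpha> x v * \<beta> x u"

definition wedge_d :: "('a::real_normed_vector \<Rightarrow> real^'n) \<Rightarrow> ('a \<Rightarrow> real^'n) \<Rightarrow> 'a form2" where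
  "wedge_d f g x u v = (\<Sum>i\<in>UNIV. wedge (ext_d (\<lambda>y. f y $ i)) (ext_d (\<lambda>y. g y $ i)) x u v)"

text \<open>Sign convention: \<open>[X, Y] f = X (Y f) - Y (X f)\<close>.\<close>

definition lie_bracket ::
    "('a::real_normed_vector \<Rightarrow> 'a) \<Rightarrow> ('a \<Rightarrow> 'a) \<Rightarrow> 'a \<Rightarrow> 'a" where
  "lie_bracket X Y x = frechet_derivative Y (at x) (X x) - frechet_derivative X (at x) (Y x)"

text \<open>\<open>(L\<^sub>X \<omega>)(Y, Z) = X (\<omega> (Y, Z)) - \<omega> ([X, Y], Z) - \<omega> (Y, [X, Z])\<close>
  for vector fields \<open>Y\<close>, \<open>Z\<close>, evaluated at the point \<open>x\<close>.\<close>

definition lie_derivative ::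
    "('a::real_normed_vector \<Rightarrow> 'a) \<Rightarrow> 'a form2 \<Rightarrow> ('a \<Rightarrow> 'a) \<Rightarrow> ('a \<Rightarrow> 'a) \<Rightarrow> 'a \<Rightarrow> real" where
  "lie_derivative X \<omega> Y Z x =
     ext_d (\<lambda>y. \<omega> y (Y y) (Z y)) x (X x)
     - \<omega> x (lie_bracket X Y x) (Z x) - \<omega> x (Y x) (lie_bracket X Z x)"

definition preserves_form ::
    "'a::euclidean_space set \<Rightarrow> ('a \<Rightarrow> 'a) \<Rightarrow> 'a form2 \<Rightarrow> bool" where
  "preserves_form M X \<omega> \<longleftrightarrow>
     (\<forall>Y Z. smooth_on M Y \<longrightarrow> smooth_on M Z \<longrightarrow> (\<forall>x\<in>M. lie_derivative X \<omega> Y Z x = 0))"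


section \<open>The coupled system\<close>

text \<open>Points of the phase space are quadruples \<open>(q\<^sub>1, p\<^sub>1, q\<^sub>2, p\<^sub>2)\<close>.\<close>

type_synonym ('n, 'm) phase = "(real^'n) \<times> (real^'n) \<times> (real^'m) \<times> (real^'m)"

definition coord_q1 :: "('n::finite, 'm::finite) phase \<Rightarrow> real^'n" where
  "coord_q1 = (\<lambda>(q1, p1, q2, p2). q1)"
definition coord_p1 :: "('n::finite, 'm::finite) phase \<Rightarrow> real^'n" where
  "coord_p1 = (\<lambda>(q1, p1, q2, p2). p1)"
definition coord_q2 :: "('n::finite, 'm::finite) phase \<Rightarrow> real^'m" where
  "coord_q2 = (\<lambda>(q1, p1, q2, p2). q2)"
definition coord_p2 :: "('n::finite, 'm::finite) phase \<Rightarrow> real^'m" where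
  "coord_p2 = (\<lambda>(q1, p1, q2, p2). p2)"

definition partial :: "('a::real_normed_vector \<Rightarrow> real) \<Rightarrow> 'a \<Rightarrow> 'a \<Rightarrow> real" where
  "partial H e x = deriv (\<lambda>t. H (x + t *\<^sub>R e)) 0"

definition grad_q1 :: "(('n::finite, 'm::finite) phase \<Rightarrow> real) \<Rightarrow> ('n, 'm) phase \<Rightarrow> real^'n" where
  "grad_q1 H x = (\<chi> i. partial H (axis i 1, 0, 0, 0) x)"
definition grad_p1 :: "(('n::finite, 'm::finite) phase \<Rightarrow> real) \<Rightarrow> ('n, 'm) phase \<Rightarrow> real^'n" where
  "grad_p1 H x = (\<chi> i. partial H (0, axis i 1, 0, 0) x)"
definition grad_q2 :: "(('n::finite, 'm::finite) phase \<Rightarrow> real) \<Rightarrow> ('n, 'm) phase \<Rightarrow> real^'m" where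
  "grad_q2 H x = (\<chi> i. partial H (0, 0, axis i 1, 0) x)"
definition grad_p2 :: "(('n::finite, 'm::finite) phase \<Rightarrow> real) \<Rightarrow> ('n, 'm) phase \<Rightarrow> real^'m" where
  "grad_p2 H x = (\<chi> i. partial H (0, 0, 0, axis i 1) x)"

definition depends_only_on :: "'a set \<Rightarrow> ('a \<Rightarrow> 'c) \<Rightarrow> ('a \<Rightarrow> 'b) \<Rightarrow> bool" where
  "depends_only_on M c H \<longleftrightarrow> (\<forall>x\<in>M. \<forall>y\<in>M. c x = c y \<longrightarrow> H x = H y)"

definition coupled_field ::
    "(('n::finite, 'm::finite) phase \<Rightarrow> real) \<Rightarrow> (('n, 'm) phase \<Rightarrow> real) \<Rightarrow>
     (('n, 'm) phase \<Rightarrow> real^'n) \<Rightarrow> (('n, 'm) phase \<Rightarrow> real^'m) \<Rightarrow>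
     ('n, 'm) phase \<Rightarrow> ('n, 'm) phase" where
  "coupled_field H1 H2 f1 f2 x =
     (grad_p1 H1 x, - grad_q1 H1 x + f1 x, grad_p2 H2 x, - grad_q2 H2 x + f2 x)"

definition symplectic_form :: "('n::finite, 'm::finite) phase form2" where
  "symplectic_form x u v = wedge_d coord_q1 coord_p1 x u v + wedge_d coord_q2 coord_p2 x u v"

end

theory Submission
  imports Defs
begin

text \<open>Write \<open>\<sigma>\<close> for the constant bilinear form \<open>\<omega>\<close>. The Lie derivative of \<open>\<omega>\<close> along \<open>X\<close> is then
  \<open>\<sigma> (DX Y) Z + \<sigma> Y (DX Z)\<close>. Since \<open>H\<^sub>1\<close> and \<open>H\<^sub>2\<close> only see their own variables, contracting with
  \<open>X\<close> gives \<open>\<sigma> (X y) v = D(H\<^sub>1 + H\<^sub>2)(y) v - f\<^sub>1(y) \<bullet> dq\<^sub>1(v) - f\<^sub>2(y) \<bullet> dq\<^sub>2(v)\<close>. Differentiating this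
  in the direction \<open>u\<close> and antisymmetrising in \<open>u, v\<close>, the Hessian of \<open>H\<^sub>1 + H\<^sub>2\<close> cancels, and what
  remains is \<open>- (df\<^sub>1 \<and> dq\<^sub>1 + df\<^sub>2 \<and> dq\<^sub>2)(u, v)\<close>.\<close>

section \<open>Directional derivatives and symmetry of the Hessian\<close>

lemma frechet_derivative_eqI:
  assumes "(f has_derivative f') (at x)"
  shows "frechet_derivative f (at x) = f'"
  using assms frechet_derivative_at by metis

lemma has_real_derivative_line:
  fixes f :: "'a::real_normed_vector \<Rightarrow> real"
  assumes "f differentiable (at (x + t *\<^sub>R v))"
  shows "((\<lambda>t. f (x + t *\<^sub>R v)) has_real_derivative frechet_derivative f (at (x + t *\<^sub>R v)) v) (at t)"
proof -
  let ?D = "frechet_derivative f (at (x + t *\<^sub>R v))"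
  have D: "(f has_derivative ?D) (at (x + t *\<^sub>R v))"
    using assms frechet_derivative_works by blast
  have "((\<lambda>t. x + t *\<^sub>R v) has_derivative (\<lambda>s. s *\<^sub>R v)) (at t)"
    by (auto intro!: derivative_eq_intros)
  from has_derivative_compose[OF this D]
  have "((\<lambda>t. f (x + t *\<^sub>R v)) has_derivative (\<lambda>s. ?D (s *\<^sub>R v))) (at t)" .
  moreover have "(\<lambda>s. ?D (s *\<^sub>R v)) = (*) (?D v)"
    using linear_scale[OF has_derivative_linear[OF D]] by (auto simp: mult.commute)
  ultimately show ?thesis by (simp add: has_field_derivative_def)
qed

lemma partial_eq_frechet_derivative:
  assumes "H differentiable (at x)"
  shows "partial H e x = frechet_derivative H (at x) e"
  unfolding partial_def
  using has_real_derivative_line[of H x 0 e] assms by (auto intro!: DERIV_imp_deriv)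

text \<open>Openness of \<open>M\<close> puts all points with small \<open>t\<close> inside
  \<open>M\<close>, so the restriction to the line is locally constant at \<open>t = 0\<close>. This
  turns the restricted dependence of \<open>H1\<close> and \<open>H2\<close> into vanishing cross
  derivatives.\<close>

lemma frechet_derivative_eq_0_if_constant_along:
  fixes H :: "'a::real_normed_vector \<Rightarrow> real"
  assumes M: "open M" "x \<in> M" and H: "H differentiable (at x)"
    and const: "\<And>t. x + t *\<^sub>R v \<in> M \<Longrightarrow> H (x + t *\<^sub>R v) = H x"
  shows "frechet_derivative H (at x) v = 0"
proof -
  have "open ((\<lambda>t. x + t *\<^sub>R v) -` M)"
    by (intro open_vimage M continuous_intros)
  with M(2) const have "eventually (\<lambda>t. H (x + t *\<^sub>R v) = H x) (nhds 0)"
    unfolding eventually_nhds by (intro exI[of _ "(\<lambda>t. x + t *\<^sub>R v) -` M"]) auto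
  then have "((\<lambda>t. H (x + t *\<^sub>R v)) has_real_derivative 0) (at 0)"
    by (subst DERIV_cong_ev[OF refl _ refl, where g = "\<lambda>_. H x"]) auto
  moreover have "((\<lambda>t. H (x + t *\<^sub>R v)) has_real_derivative frechet_derivative H (at x) v) (at 0)"
    using has_real_derivative_line[of H x 0 v] H by simp
  ultimately show ?thesis using DERIV_unique by blast
qed

lemma Ck_on_2D:
  assumes "Ck_on 2 M H"
  shows "x \<in> M \<Longrightarrow> H differentiable (at x)"
    and "x \<in> M \<Longrightarrow> (\<lambda>z. frechet_derivative H (at z) u) differentiable (at x)"
    and "continuous_on M (\<lambda>y. frechet_derivative (\<lambda>z. frechet_derivative H (at z) u) (at y) v)"
  using assms by (auto simp: numeral_2_eq_2)

text \<open>Two mean value theorems in succession: one along \<open>u\<close>, for the increment of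
  \<open>H\<close> under the shift by \<open>s\<close> times \<open>v\<close>, then one along
  \<open>v\<close>, for the derivative of \<open>H\<close> in direction \<open>u\<close>.\<close>

lemma second_difference_mean_value:
  fixes H :: "'a::real_normed_vector \<Rightarrow> real"
  assumes "s > 0"
    and S: "\<And>a b. 0 \<le> a \<Longrightarrow> a \<le> s \<Longrightarrow> 0 \<le> b \<Longrightarrow> b \<le> s \<Longrightarrow> x + a *\<^sub>R u + b *\<^sub>R v \<in> S"
    and D1: "\<And>y. y \<in> S \<Longrightarrow> H differentiable (at y)"
    and D2: "\<And>y. y \<in> S \<Longrightarrow> (\<lambda>z. frechet_derivative H (at z) u) differentiable (at y)"
  obtains a b where "0 < a" "a < s" "0 < b" "b < s"
    "H (x + s *\<^sub>R u + s *\<^sub>R v) - H (x + s *\<^sub>R u) - (H (x + s *\<^sub>R v) - H x) =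
       s * (s * frechet_derivative (\<lambda>z. frechet_derivative H (at z) u) (at (x + a *\<^sub>R u + b *\<^sub>R v)) v)"
proof -
  let ?G = "\<lambda>z. frechet_derivative H (at z) u"
  have "((\<lambda>t. H (x + s *\<^sub>R v + t *\<^sub>R u) - H (x + t *\<^sub>R u)) has_real_derivative
      ?G (x + s *\<^sub>R v + a *\<^sub>R u) - ?G (x + a *\<^sub>R u)) (at a)"
    if "0 \<le> a" "a \<le> s" for a
    using S[of a s] S[of a 0] that \<open>s > 0\<close>
    by (intro DERIV_diff has_real_derivative_line D1) (auto simp: add_ac)
  from MVT2[OF \<open>s > 0\<close> this] obtain a where a: "0 < a" "a < s"
    and eq1: "H (x + s *\<^sub>R v + s *\<^sub>R u) - H (x + s *\<^sub>R u) - (H (x + s *\<^sub>R v) - H x)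
      = s * (?G (x + s *\<^sub>R v + a *\<^sub>R u) - ?G (x + a *\<^sub>R u))"
    by auto
  have "((\<lambda>t. ?G (x + a *\<^sub>R u + t *\<^sub>R v)) has_real_derivative
      frechet_derivative ?G (at (x + a *\<^sub>R u + b *\<^sub>R v)) v) (at b)"
    if "0 \<le> b" "b \<le> s" for b
    using S[of a b] that a by (intro has_real_derivative_line D2) auto
  from MVT2[OF \<open>s > 0\<close> this] obtain b where b: "0 < b" "b < s"
    and eq2: "?G (x + a *\<^sub>R u + s *\<^sub>R v) - ?G (x + a *\<^sub>R u)
      = s * frechet_derivative ?G (at (x + a *\<^sub>R u + b *\<^sub>R v)) v"
    by auto
  show ?thesis
    using that[OF a b] eq1 eq2 by (simp add: add_ac)
qed

text \<open>Schwarz's theorem. The second difference over a small parallelogram is symmetric in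
  \<open>u\<close> and \<open>v\<close>, so the two mixed derivatives agree at a pair of points
  close to \<open>x\<close>; continuity carries this over to \<open>x\<close>.\<close>

lemma second_derivative_symmetric:
  fixes H :: "'a::euclidean_space \<Rightarrow> real"
  assumes M: "open M" "x \<in> M" and H: "smooth_on M H"
  shows "frechet_derivative (\<lambda>z. frechet_derivative H (at z) u) (at x) v =
         frechet_derivative (\<lambda>z. frechet_derivative H (at z) v) (at x) u"
proof -
  define A where "A = (\<lambda>u v y. frechet_derivative (\<lambda>z. frechet_derivative H (at z) u) (at y) v)"
  have "Ck_on 2 M H" using H by (simp add: smooth_on_def)
  note D1 = Ck_on_2D(1)[OF this] and D2 = Ck_on_2D(2)[OF this] and C = Ck_on_2D(3)[OF this]
  have cont: "isCont (A w w') x" for w w'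
    using C M by (simp add: A_def continuous_on_eq_continuous_at)
  have "\<bar>A u v x - A v u x\<bar> \<le> e" if "e > 0" for e :: real
  proof -
    obtain d1 where d1: "d1 > 0" "\<And>y. dist y x < d1 \<Longrightarrow> dist (A u v y) (A u v x) < e / 2"
      using cont[of u v] \<open>e > 0\<close> unfolding continuous_at_eps_delta by (meson half_gt_zero)
    obtain d2 where d2: "d2 > 0" "\<And>y. dist y x < d2 \<Longrightarrow> dist (A v u y) (A v u x) < e / 2"
      using cont[of v u] \<open>e > 0\<close> unfolding continuous_at_eps_delta by (meson half_gt_zero)
    obtain d3 where d3: "d3 > 0" "ball x d3 \<subseteq> M"
      using M openE by blast
    define d where "d = min d1 (min d2 d3)"
    \<comment> \<open>This scale keeps the whole parallelogram at distance less than
      \<open>d\<close> from \<open>x\<close>. The summand 1 makes the denominator positive even if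
      \<open>u\<close> and \<open>v\<close> vanish, and makes the estimate strict.\<close>
    define s where "s = d / (norm u + norm v + 1)"
    have "d > 0" using d1 d2 d3 by (auto simp: d_def)
    have pos: "norm u + norm v + 1 > 0" by (simp add: add_nonneg_pos)
    have "s > 0" using \<open>d > 0\<close> pos by (simp add: s_def)
    have near: "dist (x + a *\<^sub>R u + b *\<^sub>R v) x < d"
      if "0 \<le> a" "a \<le> s" "0 \<le> b" "b \<le> s" for a b
    proof -
      have "dist (x + a *\<^sub>R u + b *\<^sub>R v) x = norm (a *\<^sub>R u + b *\<^sub>R v)"
        by (simp add: dist_norm algebra_simps)
      also have "\<dots> \<le> a * norm u + b * norm v"
        using norm_triangle_ineq[of "a *\<^sub>R u" "b *\<^sub>R v"] that by simp
      also have "\<dots> \<le> s * norm u + s * norm v"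
        using that by (intro add_mono mult_right_mono) auto
      also have "\<dots> < s * (norm u + norm v + 1)"
        using \<open>s > 0\<close> by (simp add: algebra_simps)
      also have "\<dots> = d" using pos by (simp add: s_def)
      finally show ?thesis .
    qed
    have sub: "x + a *\<^sub>R u + b *\<^sub>R v \<in> M" if "0 \<le> a" "a \<le> s" "0 \<le> b" "b \<le> s" for a b
      using near[OF that] d3 by (auto simp: d_def dist_commute)
    have sub': "x + a *\<^sub>R v + b *\<^sub>R u \<in> M" if "0 \<le> a" "a \<le> s" "0 \<le> b" "b \<le> s" for a b
      using sub[of b a] that by (simp add: add_ac)
    obtain a b where ab: "0 < a" "a < s" "0 < b" "b < s" and
      eq: "H (x + s *\<^sub>R u + s *\<^sub>R v) - H (x + s *\<^sub>R u) - (H (x + s *\<^sub>R v) - H x) =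
        s * (s * A u v (x + a *\<^sub>R u + b *\<^sub>R v))"
      unfolding A_def using second_difference_mean_value[OF \<open>s > 0\<close> sub D1 D2] by blast
    obtain a' b' where ab': "0 < a'" "a' < s" "0 < b'" "b' < s" and
      eq': "H (x + s *\<^sub>R v + s *\<^sub>R u) - H (x + s *\<^sub>R v) - (H (x + s *\<^sub>R u) - H x) =
        s * (s * A v u (x + a' *\<^sub>R v + b' *\<^sub>R u))"
      unfolding A_def using second_difference_mean_value[OF \<open>s > 0\<close> sub' D1 D2] by blast
    \<comment> \<open>Both sides are the same second difference; \<open>a'\<close> and
      \<open>b'\<close> trade places because \<open>eq'\<close> comes from exchanging
      \<open>u\<close> and \<open>v\<close>.\<close>
    have "s * (s * A u v (x + a *\<^sub>R u + b *\<^sub>R v)) = s * (s * A v u (x + b' *\<^sub>R u + a' *\<^sub>R v))"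
      using eq eq' unfolding add.assoc add.commute[of "_ *\<^sub>R v" "_ *\<^sub>R u"] by linarith
    then have "A u v (x + a *\<^sub>R u + b *\<^sub>R v) = A v u (x + b' *\<^sub>R u + a' *\<^sub>R v)"
      using \<open>s > 0\<close> by simp
    moreover have "dist (A u v (x + a *\<^sub>R u + b *\<^sub>R v)) (A u v x) < e / 2"
      using near[of a b] ab by (intro d1) (auto simp: d_def)
    moreover have "dist (A v u (x + b' *\<^sub>R u + a' *\<^sub>R v)) (A v u x) < e / 2"
      using near[of b' a'] ab' by (intro d2) (auto simp: d_def)
    ultimately show ?thesis unfolding dist_real_def by linarith
  qed
  then have "\<bar>A u v x - A v u x\<bar> \<le> 0" by (rule field_le_epsilon[of _ 0, simplified])
  then show ?thesis by (simp add: A_def)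
qed


section \<open>The symplectic form\<close>

lemma coord_simps [simp]:
  "coord_q1 = fst" "coord_p1 = (\<lambda>x. fst (snd x))"
  "coord_q2 = (\<lambda>x. fst (snd (snd x)))" "coord_p2 = (\<lambda>x. snd (snd (snd x)))"
  by (auto simp: coord_q1_def coord_p1_def coord_q2_def coord_p2_def)

definition sympl :: "('n::finite, 'm::finite) phase \<Rightarrow> ('n, 'm) phase \<Rightarrow> real" where
  "sympl u v = coord_q1 u \<bullet> coord_p1 v - coord_p1 u \<bullet> coord_q1 v
     + (coord_q2 u \<bullet> coord_p2 v - coord_p2 u \<bullet> coord_q2 v)"

lemma ext_d_linear_component:
  assumes "bounded_linear c"
  shows "ext_d (\<lambda>y. c y $ i) x v = c v $ i"
proof -
  have "((\<lambda>y. c y $ i) has_derivative (\<lambda>y. c y $ i)) (at x)"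
    by (intro bounded_linear_imp_has_derivative bounded_linear_compose[OF bounded_linear_vec_nth assms])
  then show ?thesis by (simp add: ext_d_def frechet_derivative_eqI)
qed

lemma bounded_linear_coords:
  "bounded_linear (coord_q1 :: ('n::finite, 'm::finite) phase \<Rightarrow> _)"
  "bounded_linear (coord_p1 :: ('n::finite, 'm::finite) phase \<Rightarrow> _)"
  "bounded_linear (coord_q2 :: ('n::finite, 'm::finite) phase \<Rightarrow> _)"
  "bounded_linear (coord_p2 :: ('n::finite, 'm::finite) phase \<Rightarrow> _)"
  unfolding coord_simps by (intro bounded_linear_intros)+

text \<open>The coordinate maps are linear, hence equal to their own derivatives, so the base point
  drops out.\<close>

lemma symplectic_form_eq_sympl: "symplectic_form x u v = sympl u v"
  unfolding symplectic_form_def wedge_d_def wedge_def sympl_def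
  by (simp add: ext_d_linear_component[OF bounded_linear_coords(1), simplified]
      ext_d_linear_component[OF bounded_linear_coords(2), simplified]
      ext_d_linear_component[OF bounded_linear_coords(3), simplified]
      ext_d_linear_component[OF bounded_linear_coords(4), simplified]
      inner_vec_def sum_subtractf mult.commute)

lemma bounded_bilinear_sympl: "bounded_bilinear sympl"
  unfolding bilinear_conv_bounded_bilinear[symmetric] bilinear_def sympl_def
  by (auto intro!: linearI simp: inner_simps algebra_simps)

lemma sympl_commute: "sympl v u = - sympl u v"
  by (simp add: sympl_def inner_commute)

text \<open>The second argument is \<open>w\<close> turned by the standard complex structure.
  Components of a vector field thus become contractions with \<open>sympl\<close>, and the
  differentiability of the latter passes to the field.\<close>

lemma sympl_rotate:
  "sympl u (- coord_p1 w, coord_q1 w, - coord_p2 w, coord_q2 w) = u \<bullet> w"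
  by (cases u; cases w) (auto simp: sympl_def)

text \<open>By the product rule for a constant bilinear form, the terms with the derivatives of
  \<open>Y\<close> and \<open>Z\<close> cancel against those in the two brackets.\<close>

lemma lie_derivative_symplectic_form:
  assumes X: "X differentiable (at x)" and Y: "Y differentiable (at x)" and Z: "Z differentiable (at x)"
  shows "lie_derivative X symplectic_form Y Z x =
    sympl (frechet_derivative X (at x) (Y x)) (Z x) + sympl (Y x) (frechet_derivative X (at x) (Z x))"
proof -
  interpret bounded_bilinear sympl by (rule bounded_bilinear_sympl)
  have "((\<lambda>y. sympl (Y y) (Z y)) has_derivative
     (\<lambda>h. sympl (Y x) (frechet_derivative Z (at x) h) + sympl (frechet_derivative Y (at x) h) (Z x))) (at x)"
    using Y Z frechet_derivative_works by (blast intro: FDERIV)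
  then show ?thesis
    unfolding lie_derivative_def symplectic_form_eq_sympl ext_d_def lie_bracket_def
    by (simp add: frechet_derivative_eqI diff_left diff_right)
qed


section \<open>The coupled field\<close>

lemma inner_axis_values:
  fixes g :: "real^'n::finite \<Rightarrow> real"
  assumes "linear g"
  shows "(\<chi> i. g (axis i 1)) \<bullet> v = g v"
proof -
  have "g v = g (\<Sum>i\<in>UNIV. v $ i *\<^sub>R axis i 1)"
    using basis_expansion[of v] by (simp add: scalar_mult_eq_scaleR)
  also have "\<dots> = (\<Sum>i\<in>UNIV. v $ i * g (axis i 1))"
    using assms by (simp add: linear_sum linear_scale)
  finally show ?thesis by (simp add: inner_vec_def mult.commute)
qed

text \<open>Partial derivatives are values of the total derivative on axis vectors, and linearity
  extends this to a whole block of coordinates.\<close>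

lemma inner_grads:
  fixes H :: "('n::finite, 'm::finite) phase \<Rightarrow> real"
  assumes "H differentiable (at x)"
  shows "grad_q1 H x \<bullet> a = frechet_derivative H (at x) (a, 0, 0, 0)"
    and "grad_p1 H x \<bullet> a = frechet_derivative H (at x) (0, a, 0, 0)"
    and "grad_q2 H x \<bullet> b = frechet_derivative H (at x) (0, 0, b, 0)"
    and "grad_p2 H x \<bullet> b = frechet_derivative H (at x) (0, 0, 0, b)"
proof -
  let ?D = "frechet_derivative H (at x)"
  have lin: "linear ?D" using assms by (rule linear_frechet_derivative)
  have c: "linear (\<lambda>a. ?D (j a))" if "linear j" for j :: "'c::real_vector \<Rightarrow> ('n, 'm) phase"
    using linear_compose[OF that lin] by (simp add: o_def)
  note p = partial_eq_frechet_derivative[OF assms]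
  show "grad_q1 H x \<bullet> a = ?D (a, 0, 0, 0)"
    unfolding grad_q1_def p by (rule inner_axis_values, rule c) (auto intro!: linearI)
  show "grad_p1 H x \<bullet> a = ?D (0, a, 0, 0)"
    unfolding grad_p1_def p by (rule inner_axis_values, rule c) (auto intro!: linearI)
  show "grad_q2 H x \<bullet> b = ?D (0, 0, b, 0)"
    unfolding grad_q2_def p by (rule inner_axis_values, rule c) (auto intro!: linearI)
  show "grad_p2 H x \<bullet> b = ?D (0, 0, 0, b)"
    unfolding grad_p2_def p by (rule inner_axis_values, rule c) (auto intro!: linearI)
qed

text \<open>The signs in \<open>sympl\<close> undo those in Hamilton's equations, so the gradient
  blocks add up to total derivatives, once \<open>H1\<close> is known to have zero derivative along
  \<open>(0, 0, c, d)\<close> and \<open>H2\<close> along \<open>(a, b, 0, 0)\<close>.\<close>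

lemma sympl_coupled_field:
  fixes M :: "('n::finite, 'm::finite) phase set"
  assumes M: "open M" "y \<in> M"
    and H1: "H1 differentiable (at y)" and dep1: "depends_only_on M (\<lambda>x. (coord_q1 x, coord_p1 x)) H1"
    and H2: "H2 differentiable (at y)" and dep2: "depends_only_on M (\<lambda>x. (coord_q2 x, coord_p2 x)) H2"
  shows "sympl (coupled_field H1 H2 f1 f2 y) v =
    frechet_derivative H1 (at y) v + frechet_derivative H2 (at y) v
    - f1 y \<bullet> coord_q1 v - f2 y \<bullet> coord_q2 v"
proof -
  obtain a b c d where v: "v = (a, b, c, d)" by (cases v)
  let ?D1 = "frechet_derivative H1 (at y)" and ?D2 = "frechet_derivative H2 (at y)"
  have lin: "linear ?D1" "linear ?D2"
    using H1 H2 by (auto intro: linear_frechet_derivative)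
  have "?D1 (0, 0, c, d) = 0"
  proof (rule frechet_derivative_eq_0_if_constant_along[OF M H1])
    fix t assume "y + t *\<^sub>R (0, 0, c, d) \<in> M"
    with M(2) show "H1 (y + t *\<^sub>R (0, 0, c, d)) = H1 y"
      by (intro dep1[unfolded depends_only_on_def, rule_format]) auto
  qed
  moreover have "?D2 (a, b, 0, 0) = 0"
  proof (rule frechet_derivative_eq_0_if_constant_along[OF M H2])
    fix t assume "y + t *\<^sub>R (a, b, 0, 0) \<in> M"
    with M(2) show "H2 (y + t *\<^sub>R (a, b, 0, 0)) = H2 y"
      by (intro dep2[unfolded depends_only_on_def, rule_format]) auto
  qed
  moreover have "?D1 v = ?D1 (a, 0, 0, 0) + ?D1 (0, b, 0, 0) + ?D1 (0, 0, c, d)"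
    by (simp add: linear_add[OF lin(1), symmetric] v)
  moreover have "?D2 v = ?D2 (a, b, 0, 0) + ?D2 (0, 0, c, 0) + ?D2 (0, 0, 0, d)"
    by (simp add: linear_add[OF lin(2), symmetric] v)
  ultimately show ?thesis
    by (simp add: sympl_def coupled_field_def inner_grads[OF H1] inner_grads[OF H2]
        inner_diff_left inner_add_left v)
qed

lemma wedge_d_bounded_linear_right:
  assumes f: "(f has_derivative f') (at x)" and c: "bounded_linear c"
  shows "wedge_d f c x u v = f' u \<bullet> c v - f' v \<bullet> c u"
proof -
  have "ext_d (\<lambda>y. f y $ i) x w = f' w $ i" for i w
    using frechet_derivative_eqI[OF bounded_linear.has_derivative[OF bounded_linear_vec_nth f, of i]]
    by (simp add: ext_d_def)
  then show ?thesis
    by (simp add: wedge_d_def wedge_def ext_d_linear_component[OF c] inner_vec_def sum_subtractf)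
qed

theorem theorem7:
  fixes M :: "('n::finite, 'm::finite) phase set"
    and H1 H2 :: "('n, 'm) phase \<Rightarrow> real"
    and f1 :: "('n, 'm) phase \<Rightarrow> real^'n"
    and f2 :: "('n, 'm) phase \<Rightarrow> real^'m"
  assumes "open M"
    and "smooth_on M H1" and "depends_only_on M (\<lambda>x. (coord_q1 x, coord_p1 x)) H1"
    and "smooth_on M H2" and "depends_only_on M (\<lambda>x. (coord_q2 x, coord_p2 x)) H2"
    and "smooth_on M f1" and "smooth_on M f2"
    and "\<forall>x\<in>M. \<forall>u v. wedge_d f1 coord_q1 x u v + wedge_d f2 coord_q2 x u v = 0"
  shows "preserves_form M (coupled_field H1 H2 f1 f2) symplectic_form"
  unfolding preserves_form_def
proof (intro allI impI ballI)
  fix Y Z :: "('n, 'm) phase \<Rightarrow> ('n, 'm) phase" and x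
  assume Y: "smooth_on M Y" and Z: "smooth_on M Z" and x: "x \<in> M"
  let ?X = "coupled_field H1 H2 f1 f2"
  have Ck: "Ck_on 1 M Y" "Ck_on 1 M Z" "Ck_on 1 M f1" "Ck_on 1 M f2" "Ck_on 2 M H1" "Ck_on 2 M H2"
    using assms Y Z by (auto simp: smooth_on_def)
  have D: "Y differentiable (at x)" "Z differentiable (at x)" "f1 differentiable (at x)"
    "f2 differentiable (at x)"
    using Ck x by auto
  have DH: "H1 differentiable (at y)" "H2 differentiable (at y)" if "y \<in> M" for y
    using Ck_on_2D(1)[OF Ck(5) that] Ck_on_2D(1)[OF Ck(6) that] by auto
  define F1 F2 where "F1 = frechet_derivative f1 (at x)" and "F2 = frechet_derivative f2 (at x)"
  define A1 A2 where
    "A1 = (\<lambda>v. frechet_derivative (\<lambda>z. frechet_derivative H1 (at z) v) (at x))" and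
    "A2 = (\<lambda>v. frechet_derivative (\<lambda>z. frechet_derivative H2 (at z) v) (at x))"
  have F: "(f1 has_derivative F1) (at x)" "(f2 has_derivative F2) (at x)"
    unfolding F1_def F2_def using D frechet_derivative_works by auto
  have A: "((\<lambda>z. frechet_derivative H1 (at z) v) has_derivative A1 v) (at x)"
    "((\<lambda>z. frechet_derivative H2 (at z) v) has_derivative A2 v) (at x)" for v
    unfolding A1_def A2_def frechet_derivative_works[symmetric]
    by (rule Ck_on_2D(2)[OF Ck(5) x] Ck_on_2D(2)[OF Ck(6) x])+
  \<comment> \<open>\<open>B v u\<close> is the derivative at \<open>x\<close>, in direction
    \<open>u\<close>, of the field contracted with the fixed vector \<open>v\<close>.\<close>
  define B where "B = (\<lambda>v u. A1 v u + A2 v u - F1 u \<bullet> coord_q1 v - F2 u \<bullet> coord_q2 v)"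
  have deriv: "((\<lambda>y. sympl (?X y) v) has_derivative B v) (at x)" for v
  \<comment> \<open>The contraction formula is available only on \<open>M\<close>; openness makes
    that enough for the derivative at \<open>x\<close>.\<close>
  proof (rule has_derivative_transform_within_open[OF _ \<open>open M\<close> x])
    show "((\<lambda>y. frechet_derivative H1 (at y) v + frechet_derivative H2 (at y) v
        - f1 y \<bullet> coord_q1 v - f2 y \<bullet> coord_q2 v) has_derivative B v) (at x)"
      unfolding B_def by (intro derivative_intros A has_derivative_inner_left F)
  qed (rule sympl_coupled_field[symmetric, OF assms(1) _ DH(1) assms(3) DH(2) assms(5)])
  \<comment> \<open>By \<open>sympl_rotate\<close>, each component of the field is a contraction
    with a fixed vector, to which \<open>deriv\<close> applies.\<close>
  have X: "?X differentiable (at x)"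
  proof (rule differentiable_componentwise_within[THEN iffD2], rule ballI)
    show "(\<lambda>y. ?X y \<bullet> b) differentiable (at x)" for b
      unfolding sympl_rotate[symmetric] by (rule differentiableI deriv)+
  qed
  \<comment> \<open>Contraction with \<open>v\<close> is bounded linear and so commutes with
    differentiation; uniqueness of derivatives identifies the result with
    \<open>B v\<close>.\<close>
  have DX: "sympl (frechet_derivative ?X (at x) u) v = B v u" for u v
  proof -
    have "((\<lambda>y. sympl (?X y) v) has_derivative (\<lambda>u. sympl (frechet_derivative ?X (at x) u) v)) (at x)"
      using X unfolding frechet_derivative_works
      by (rule bounded_linear.has_derivative[OF bounded_bilinear.bounded_linear_left[OF bounded_bilinear_sympl]])
    from has_derivative_unique[OF this deriv] show ?thesis by (rule fun_cong)
  qed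
  have A_sym: "A1 u v = A1 v u" "A2 u v = A2 v u" for u v
    unfolding A1_def A2_def
    by (rule second_derivative_symmetric[OF assms(1) x assms(2)]
        second_derivative_symmetric[OF assms(1) x assms(4)])+
  have "F1 u \<bullet> coord_q1 v - F1 v \<bullet> coord_q1 u + (F2 u \<bullet> coord_q2 v - F2 v \<bullet> coord_q2 u) = 0" for u v
    using assms(8)[rule_format, OF x, of u v]
    unfolding wedge_d_bounded_linear_right[OF F(1) bounded_linear_coords(1)]
      wedge_d_bounded_linear_right[OF F(2) bounded_linear_coords(3)] .
  \<comment> \<open>The second derivatives cancel by symmetry, leaving minus the wedge condition
    evaluated at \<open>Y x\<close> and \<open>Z x\<close>.\<close>
  from this[of "Y x" "Z x"] have "B (Z x) (Y x) - B (Y x) (Z x) = 0"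
    unfolding B_def A_sym[of "Y x" "Z x"] by linarith
  \<comment> \<open>Antisymmetry of \<open>sympl\<close> makes the second summand of the Lie
    derivative equal to \<open>- B (Y x) (Z x)\<close>.\<close>
  then show "lie_derivative ?X symplectic_form Y Z x = 0"
    unfolding lie_derivative_symplectic_form[OF X D(1,2)]
    by (simp add: sympl_commute[of "Y x"] DX)
qed

end
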